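(* Let $m,n\geq1$ be integers with $m\geq n$ and $m+n$ even. For every integer $j$ with $0\leq 2j\leq m$, $$\operatorname{sgn}\left([u^{2j}](u\cot u)^{m+1}\right)=(-1)^j .$$ Consequently, in the expansion $$\int_0^\infty \frac{\tanh^{m+1}x}{x^{n+1}}\,dx = (-1)^{(m-n)/2}\sum_{p=\lceil n/2\rceil}^{(m+n)/2}\binom{2p}{n}(2^{2p+1}-1)\frac{\zeta(2p+1)}{\pi^{2p}}\,[u^{m+n-2p}](u\cot u)^{m+1},$$ the nonzero zeta coefficients $(-1)^{(m-n)/2}\binom{2p}{n}(2^{2p+1}-1)\,[u^{m+n-2p}](u\cot u)^{m+1}$ of $\zeta(2p+1)/\pi^{2p}$, $\lceil n/2\rceil\le p\le (m+n)/2$, alternate in sign as $p$ increases by one.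
   Context: $\zeta$ is the Riemann zeta function. $[u^r]F(u)$ denotes the coefficient of $u^r$ in the expansion of $F$ at the origin; $u\cot u$ is extended holomorphically to $u=0$ with value $1$. $\operatorname{sgn}$ is the sign of a real number. *)

theory Defs
  imports "HOL-Complex_Analysis.Complex_Analysis"
begin

(* The Dirichlet series of the Riemann zeta function; it is the zeta function only for s > 1
   (no analytic continuation), which covers the arguments 2p + 1 with p \<ge> 1 used here. *)
definition zeta :: "real \<Rightarrow> real" where
  "zeta s = (\<Sum>k. 1 / real (Suc k) powr s)"

(* In the library cot 0 = 0, so the removable singularity has to be filled in by hand. *)
definition ucot :: "complex \<Rightarrow> complex" where
  "ucot u = (if u = 0 then 1 else u * cot u)"

(* [u^r] (u cot u)^k.  No information is lost by taking the real part, see ucot_coeff. *)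
definition ucot_coeff :: "nat \<Rightarrow> nat \<Rightarrow> real" where
  "ucot_coeff k r = Re (fps_nth (fps_expansion (\<lambda>u. ucot u ^ k) 0) r)"

definition zeta_coeff :: "nat \<Rightarrow> nat \<Rightarrow> nat \<Rightarrow> real" where
  "zeta_coeff m n p =
     (-1) ^ ((m - n) div 2) * real ((2 * p) choose n) * (2 ^ (2 * p + 1) - 1)
       * ucot_coeff (m + 1) (m + n - 2 * p)"

lemma ucot_has_fps_expansion:
  "ucot has_fps_expansion (fps_cos 1 * inverse (fps_shift 1 (fps_sin 1)))"
proof -
  have "fps_nth (fps_sin (1::complex)) 1 \<noteq> 0"
    by (simp add: fps_sin_def)
  then have "fps_sin (1::complex) \<noteq> 0"
    by force
  then have "(\<lambda>x::complex. cos x * inverse (if x = 0 then 1 else sin x / x ^ 1))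
          has_fps_expansion (fps_cos 1 * inverse (fps_shift 1 (fps_sin 1)))"
    by (intro fps_expansion_intros subdegree_geI) (auto simp: fps_sin_def)
  also have "(\<lambda>x::complex. cos x * inverse (if x = 0 then 1 else sin x / x ^ 1)) = ucot"
    by (auto simp: fun_eq_iff ucot_def cot_def field_simps)
  finally show ?thesis .
qed

lemma real_coeffs_mult:
  fixes F G :: "complex fps"
  assumes "\<And>n. fps_nth F n \<in> \<real>" "\<And>n. fps_nth G n \<in> \<real>"
  shows "fps_nth (F * G) n \<in> \<real>"
  using assms by (auto simp: fps_mult_nth intro!: sum_in_Reals Reals_mult)

lemma real_coeffs_power:
  fixes F :: "complex fps"
  assumes "\<And>n. fps_nth F n \<in> \<real>"
  shows "fps_nth (F ^ k) n \<in> \<real>"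
proof (induction k arbitrary: n)
  case (Suc k)
  then show ?case using real_coeffs_mult[of F "F ^ k"] assms by simp
qed simp

lemma real_coeffs_inverse:
  fixes F :: "complex fps"
  assumes "\<And>n. fps_nth F n \<in> \<real>"
  shows "fps_nth (inverse F) n \<in> \<real>"
proof (induction n rule: less_induct)
  case (less n)
  show ?case
  proof (cases n)
    case 0
    then show ?thesis using assms by simp
  next
    case (Suc k)
    then have "fps_nth (inverse F) n =
        - inverse (fps_nth F 0) * (\<Sum>i=1..n. fps_nth F i * fps_nth (inverse F) (n - i))"
      by (simp add: fps_inverse_def)
    also have "\<dots> \<in> \<real>"
      using less assms by (intro Reals_mult Reals_minus Reals_inverse sum_in_Reals) auto
    finally show ?thesis .
  qed
qed

lemma ucot_coeff:
  "complex_of_real (ucot_coeff k r) = fps_nth (fps_expansion (\<lambda>u. ucot u ^ k) 0) r"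
proof -
  have sin: "fps_nth (fps_sin (1::complex)) n \<in> \<real>" and
       cos: "fps_nth (fps_cos (1::complex)) n \<in> \<real>" for n
    by (auto simp: fps_sin_def fps_cos_def intro!: Reals_divide Reals_power Reals_minus fact_in_Reals)
  have "fps_nth ((fps_cos (1::complex) * inverse (fps_shift 1 (fps_sin 1))) ^ k) r \<in> \<real>"
    by (intro real_coeffs_power real_coeffs_mult real_coeffs_inverse) (simp_all add: sin cos)
  then show ?thesis
    using fps_expansion_eqI[OF has_fps_expansion_power[OF ucot_has_fps_expansion]]
    by (simp add: ucot_coeff_def)
qed

end

theory Submission
  imports Defs "HOL-Real_Asymp.Real_Asymp"
begin

text \<open>
  With \<open>a k r = [u^r] (u cot u)^k\<close>, the differential equation
  \<open>u U' = U - u^2 - U^2\<close> of \<open>U = u cot u\<close> gives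
  \<open>k a (k+1) r = (k - r) a k r - k a (k-1) (r-2)\<close>, from which the signs follow by induction on
  \<open>k\<close>. Integrating the derivative of \<open>tanh^k x / x^s\<close> gives a recurrence of the same shape for
  the integrals of \<open>tanh^k x / x^s\<close>. It leaves the range of convergence at 0, so it is used for
  Hadamard finite parts, with boundary terms that vanish when \<open>k + s\<close> is odd. It reduces every
  integral to \<open>k = 0\<close>, where the finite part is 0, and to \<open>k = 1\<close>, where the partial
  fractions of \<open>tanh\<close> produce the zeta values.
\<close>

subsection \<open>Coefficients of powers of $u \cot u$\<close>

abbreviation ucot_fps :: "complex fps" where
  "ucot_fps \<equiv> fps_cos 1 * inverse (fps_shift 1 (fps_sin 1))"

lemma ucot_coeff_conv_fps: "complex_of_real (ucot_coeff k r) = fps_nth (ucot_fps ^ k) r"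
  using ucot_coeff fps_expansion_eqI[OF has_fps_expansion_power[OF ucot_has_fps_expansion]]
  by simp

text \<open>With \<open>S\<close> the series of sin u / u, sin and cos are \<open>fps_X * S\<close>
  and \<open>U * S\<close>. Differentiating both products, eliminating \<open>fps_deriv S\<close>
  and cancelling the nonzero \<open>S\<close> leaves the equation, with no division of
  series.\<close>

lemma ucot_fps_ode: "fps_X * fps_deriv ucot_fps = ucot_fps - fps_X ^ 2 - ucot_fps ^ 2"
proof -
  define S where "S = fps_shift 1 (fps_sin (1::complex))"
  define U where "U = ucot_fps"
  have S0: "fps_nth S 0 \<noteq> 0" by (simp add: S_def fps_sin_def)
  then have "S \<noteq> 0" by force
  have "1 \<le> subdegree (fps_sin (1::complex))"
    by (intro subdegree_geI) (auto simp: fps_sin_def fps_eq_iff intro!: exI[of _ 1])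
  then have sin: "fps_sin 1 = fps_X * S"
    by (metis S_def fps_shift_times_fps_X_power mult.commute power_one_right)
  have cos: "fps_cos 1 = U * S"
    using inverse_mult_eq_1[OF S0] by (simp add: U_def S_def mult.assoc)
  have "fps_deriv (fps_X * S) = U * S"
    by (simp flip: sin cos add: fps_sin_deriv)
  then have 1: "fps_X * fps_deriv S = U * S - S"
    by (simp add: algebra_simps)
  have "fps_deriv (U * S) = - (fps_X * S)"
    by (simp flip: sin cos add: fps_cos_deriv fps_eq_iff)
  then have "fps_X * fps_deriv U * S + U * (fps_X * fps_deriv S) = - (fps_X ^ 2 * S)"
    by (metis (no_types, opaque_lifting) distrib_left fps_deriv_mult mult.assoc mult.commute mult_minus_right power2_eq_square add.commute)
  then have "(fps_X * fps_deriv U) * S = (U - fps_X ^ 2 - U ^ 2) * S"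
    unfolding 1 by (simp add: algebra_simps power2_eq_square eq_neg_iff_add_eq_0)
  then show ?thesis using \<open>S \<noteq> 0\<close> by (simp add: U_def)
qed

lemma ucot_coeff_0_right [simp]: "ucot_coeff k 0 = 1"
  using ucot_coeff_conv_fps[of k 0]
  by (simp add: fps_sin_def fps_cos_def fps_power_zeroth)

text \<open>This is the coefficient of u^r in u (U^k)' = k U^(k-1) (u U'), after
  \<open>ucot_fps_ode\<close> is substituted for u U'. The operator u d/du contributes the factor
  r.\<close>

lemma ucot_coeff_recurrence:
  assumes "k \<ge> 1" "r \<ge> 2"
  shows "real k * ucot_coeff (k + 1) r =
    (real k - real r) * ucot_coeff k r - real k * ucot_coeff (k - 1) (r - 2)"
proof -
  define U where "U = ucot_fps"
  have "fps_X * fps_deriv (U ^ k) = of_nat k * U ^ (k - 1) * (fps_X * fps_deriv U)"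
    by (simp add: fps_deriv_power' mult_ac)
  also have "\<dots> = of_nat k * (U ^ (k - 1) * U - fps_X ^ 2 * U ^ (k - 1) - U ^ (k - 1) * U ^ 2)"
    unfolding U_def ucot_fps_ode by (simp add: algebra_simps)
  also have "\<dots> = of_nat k * (U ^ k - fps_X ^ 2 * U ^ (k - 1) - U ^ (k + 1))"
    using assms(1) by (simp flip: power_Suc2 power_add)
  finally have "fps_nth (fps_X * fps_deriv (U ^ k)) r =
      fps_nth (of_nat k * (U ^ k - fps_X ^ 2 * U ^ (k - 1) - U ^ (k + 1))) r"
    by simp
  moreover have "fps_nth (fps_X * fps_deriv (U ^ k)) r = of_nat r * fps_nth (U ^ k) r"
    using assms(2) by simp
  moreover have "fps_nth (of_nat k * (U ^ k - fps_X ^ 2 * U ^ (k - 1) - U ^ (k + 1))) r =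
      of_nat k * (fps_nth (U ^ k) r - fps_nth (U ^ (k - 1)) (r - 2) - fps_nth (U ^ (k + 1)) r)"
    using assms(2) by (simp add: fps_X_power_mult_nth flip: fps_of_nat)
  ultimately have "of_nat r * complex_of_real (ucot_coeff k r) =
      of_nat k * (complex_of_real (ucot_coeff k r) - complex_of_real (ucot_coeff (k - 1) (r - 2))
        - complex_of_real (ucot_coeff (k + 1) r))"
    by (simp only: ucot_coeff_conv_fps U_def)
  then have "complex_of_real (real r * ucot_coeff k r) =
      complex_of_real (real k * (ucot_coeff k r - ucot_coeff (k - 1) (r - 2) - ucot_coeff (k + 1) r))"
    by simp
  then show ?thesis
    unfolding of_real_eq_iff by (simp add: algebra_simps)
qed

text \<open>Multiplied by (-1)^j, the recurrence has no negative term on its right side: the factor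
  l - 2 j is nonnegative for 2 j < k = l + 1, and the minus sign of the last term is absorbed by
  passing from j to j - 1. That last term supplies the strict positivity.\<close>

lemma ucot_coeff_pos: "2 * j < k \<Longrightarrow> (-1) ^ j * ucot_coeff k (2 * j) > 0"
proof (induction k arbitrary: j rule: less_induct)
  case (less k)
  show ?case
  proof (cases j)
    case (Suc i)
    obtain l where l: "k = l + 1" using less.prems by (cases k) auto
    with less.prems Suc have l': "l \<ge> 1" "2 * j \<le> l" by auto
    have "(-1) ^ j * (real l * ucot_coeff k (2 * j)) =
        (real l - real (2 * j)) * ((-1) ^ j * ucot_coeff l (2 * j))
        + real l * ((-1) ^ i * ucot_coeff (l - 1) (2 * i))"
      using arg_cong[OF ucot_coeff_recurrence[of l "2 * j"], of "\<lambda>x. (-1) ^ j * x"] l l' Suc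
      by (simp add: algebra_simps)
    moreover have "(real l - real (2 * j)) * ((-1) ^ j * ucot_coeff l (2 * j)) \<ge> 0"
    \<comment> \<open>In the boundary case 2 j = l the induction hypothesis is out of range, but the
      factor l - 2 j is 0.\<close>
    proof (cases "2 * j = l")
      case False
      then show ?thesis using l l' by (intro mult_nonneg_nonneg[OF _ less_imp_le[OF less.IH]]) auto
    qed auto
    moreover have "real l * ((-1) ^ i * ucot_coeff (l - 1) (2 * i)) > 0"
      using l l' Suc by (intro mult_pos_pos[OF _ less.IH]) auto
    ultimately have "real l * ((-1) ^ j * ucot_coeff k (2 * j)) > 0"
      by (simp add: mult_ac)
    then show ?thesis using l' by (simp add: zero_less_mult_iff)
  qed auto
qed

lemma sgn_ucot_coeff:
  assumes "2 * j < k" shows "sgn (ucot_coeff k (2 * j)) = (-1) ^ j"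
  using ucot_coeff_pos[OF assms] by (cases "even j") (auto simp: zero_less_mult_iff)

subsection \<open>Partial fractions of the hyperbolic tangent\<close>

text \<open>The poles of \<open>tanh\<close> are \<open>\<plusminus> i\<close> times these numbers.\<close>
definition tanh_pole :: "nat \<Rightarrow> real" where
  "tanh_pole k = (2 * real k + 1) * pi / 2"

lemma tanh_pole_pos [simp]: "tanh_pole k > 0"
  by (simp add: tanh_pole_def add_nonneg_pos)

lemma tanh_pole_nonzero [simp]: "tanh_pole k \<noteq> 0"
  using tanh_pole_pos[of k] by linarith

text \<open>From cosh x = sinh (2 x) / (2 sinh x): in the product for sinh (2 x) the factors of even
  index are exactly those of sinh x and cancel, while those of odd index give the
  \<open>tanh_pole\<close> factors.\<close>

lemma cosh_product_formula:
  fixes x :: real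
  shows "(\<lambda>n. \<Prod>k<n. 1 + x ^ 2 / tanh_pole k ^ 2) \<longlonglongrightarrow> cosh x"
proof (cases "x = 0")
  case False
  define P where "P c n = (\<Prod>k=1..n. 1 + c ^ 2 / (real k * pi) ^ 2)" for c :: real and n
  \<comment> \<open>The sine product is taken at the imaginary argument i c / pi, and imaginary
    parts are compared.\<close>
  have P_lim: "P c \<longlonglongrightarrow> sinh c / c" if "c \<noteq> 0" for c
  proof -
    have "(\<lambda>n. of_real pi * (\<i> * of_real (c / pi)) *
        (\<Prod>k=1..n. 1 - (\<i> * of_real (c / pi))\<^sup>2 / (of_nat k)\<^sup>2)) \<longlonglongrightarrow>
        sin (of_real pi * (\<i> * of_real (c / pi)))"
      by (rule sin_product_formula_complex)
    also have "(\<lambda>n. of_real pi * (\<i> * of_real (c / pi)) *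
        (\<Prod>k=1..n. 1 - (\<i> * of_real (c / pi))\<^sup>2 / (of_nat k)\<^sup>2)) =
        (\<lambda>n. \<i> * complex_of_real (c * P c n))"
      by (simp add: P_def power_mult_distrib power_divide mult_ac)
    also have "sin (of_real pi * (\<i> * of_real (c / pi))) = \<i> * complex_of_real (sinh c)"
    proof -
      have "of_real pi * (\<i> * of_real (c / pi)) = \<i> * complex_of_real c" by simp
      then show ?thesis
        by (simp add: sin_i_times sinh_field_def exp_of_real exp_minus)
    qed
    finally have "(\<lambda>n. Im (\<i> * complex_of_real (c * P c n))) \<longlonglongrightarrow>
        Im (\<i> * complex_of_real (sinh c))"
      by (rule tendsto_Im)
    then have "(\<lambda>n. c * P c n) \<longlonglongrightarrow> sinh c" by simp
    from tendsto_divide[OF this tendsto_const that] that show ?thesis by simp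
  qed
  have P_pos: "P c n > 0" for c n
    unfolding P_def by (intro prod_pos) (auto intro!: add_pos_nonneg)
  have split: "P (2 * x) (2 * n) = (\<Prod>k<n. 1 + x ^ 2 / tanh_pole k ^ 2) * P x n" for n
  proof (induction n)
    case (Suc n)
    have "P (2 * x) (2 * Suc n) = P (2 * x) (2 * n) *
        (1 + (2 * x)\<^sup>2 / (real (2 * n + 1) * pi)\<^sup>2) * (1 + (2 * x)\<^sup>2 / (real (2 * n + 2) * pi)\<^sup>2)"
      by (simp add: P_def)
    also have "1 + (2 * x)\<^sup>2 / (real (2 * n + 1) * pi)\<^sup>2 = 1 + x\<^sup>2 / tanh_pole n ^ 2"
      by (simp add: tanh_pole_def power_mult_distrib power_divide ac_simps)
    also have "1 + (2 * x)\<^sup>2 / (real (2 * n + 2) * pi)\<^sup>2 = 1 + x\<^sup>2 / (real (Suc n) * pi)\<^sup>2"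
    proof -
      have "real (2 * n + 2) = 2 * real (Suc n)" by simp
      then show ?thesis by (simp only: power_mult_distrib mult.assoc) simp
    qed
    finally have *: "P (2 * x) (2 * Suc n) =
        P (2 * x) (2 * n) * (1 + x\<^sup>2 / tanh_pole n ^ 2) * (1 + x\<^sup>2 / (real (Suc n) * pi)\<^sup>2)" .
    have "P x (Suc n) = P x n * (1 + x\<^sup>2 / (real (Suc n) * pi)\<^sup>2)" by (simp add: P_def)
    then show ?case unfolding * Suc.IH by (simp only: prod.lessThan_Suc mult_ac)
  qed (simp add: P_def)
  have "(\<lambda>n. P (2 * x) (2 * n) / P x n) \<longlonglongrightarrow> (sinh (2 * x) / (2 * x)) / (sinh x / x)"
    using False
    by (intro tendsto_divide P_lim filterlim_compose[OF P_lim[of "2 * x"]]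
        filterlim_subseq strict_monoI) auto
  moreover have "(\<lambda>n. P (2 * x) (2 * n) / P x n) = (\<lambda>n. \<Prod>k<n. 1 + x ^ 2 / tanh_pole k ^ 2)"
    unfolding split using P_pos by (auto simp: fun_eq_iff less_imp_neq[THEN not_sym])
  moreover have "(sinh (2 * x) / (2 * x)) / (sinh x / x) = cosh x"
    using False by (simp add: sinh_double)
  ultimately show ?thesis by simp
qed auto

lemma summable_inverse_tanh_pole_power:
  assumes "e \<ge> 2" shows "summable (\<lambda>k. 1 / tanh_pole k ^ e)"
proof (rule summable_comparison_test')
  show "summable (\<lambda>k. inverse (real (Suc k) ^ e))"
    using inverse_power_summable[OF assms, where ?'a = real] by (subst summable_Suc_iff)
  show "norm (1 / tanh_pole k ^ e) \<le> inverse (real (Suc k) ^ e)" for k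
  proof -
    have "(2 * real k + 1) * 2 \<le> (2 * real k + 1) * pi"
      using pi_ge_two by (intro mult_left_mono) auto
    then have "real (Suc k) \<le> tanh_pole k" unfolding tanh_pole_def by simp
    then have "real (Suc k) ^ e \<le> tanh_pole k ^ e" by (intro power_mono) auto
    then have "inverse (tanh_pole k ^ e) \<le> inverse (real (Suc k) ^ e)"
      by (intro le_imp_inverse_le) auto
    then show ?thesis by (simp add: inverse_eq_divide abs_of_pos)
  qed
qed

text \<open>The logarithmic derivative of the cosh product. Termwise differentiation is justified by
  the Weierstrass test on a compact interval around \<open>x\<close>, with majorant 2 A /
  \<open>tanh_pole k ^ 2\<close>.\<close>

lemma sums_tanh: "(\<lambda>k. 2 * x / (x ^ 2 + tanh_pole k ^ 2)) sums tanh x"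
proof -
  define A where "A = \<bar>x\<bar> + 1"
  have x: "x \<in> interior {-A..A}" by (auto simp: A_def)
  define g where "g k y = ln (1 + y ^ 2 / tanh_pole k ^ 2)" for k y
  have pos: "0 < 1 + y ^ 2 / tanh_pole k ^ 2" for k y
    by (intro add_pos_nonneg) auto
  have g_sums: "(\<lambda>k. g k y) sums ln (cosh y)" for y
  proof -
    have "(\<lambda>n. ln (\<Prod>k<n. 1 + y ^ 2 / tanh_pole k ^ 2)) \<longlonglongrightarrow> ln (cosh y)"
      using cosh_real_pos[of y] by (intro tendsto_ln cosh_product_formula) auto
    then show ?thesis
      unfolding sums_def g_def by (subst (asm) ln_prod) (use pos in \<open>auto simp: less_imp_neq[THEN not_sym]\<close>)
  qed
  have deriv: "(g k has_field_derivative 2 * y / (y ^ 2 + tanh_pole k ^ 2)) (at y within {-A..A})"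
    for k y
  proof -
    have *: "((\<lambda>y. ln (1 + c * y ^ 2)) has_field_derivative 2 * c * y / (1 + c * y ^ 2))
        (at y within {-A..A})" if "c \<ge> 0" for c
      using add_pos_nonneg[of 1 "c * y ^ 2"] that by (auto intro!: derivative_eq_intros)
    have "1 + y ^ 2 / tanh_pole k ^ 2 = (y ^ 2 + tanh_pole k ^ 2) / tanh_pole k ^ 2"
      by (simp add: add_divide_distrib)
    with *[of "1 / tanh_pole k ^ 2"] show ?thesis unfolding g_def by simp
  qed
  have bd: "norm (2 * y / (y ^ 2 + tanh_pole k ^ 2)) \<le> 2 * A * (1 / tanh_pole k ^ 2)"
    if "y \<in> {-A..A}" for k y
  proof -
    have "\<bar>2 * y\<bar> \<le> 2 * A" using that by auto
    moreover have "tanh_pole k ^ 2 \<le> y ^ 2 + tanh_pole k ^ 2" by simp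
    ultimately have "\<bar>2 * y\<bar> / (y ^ 2 + tanh_pole k ^ 2) \<le> 2 * A / tanh_pole k ^ 2"
      by (intro frac_le) auto
    moreover have "y ^ 2 + tanh_pole k ^ 2 > 0" by (intro add_nonneg_pos) auto
    ultimately show ?thesis by simp
  qed
  have summ: "summable (\<lambda>k. 2 * A * (1 / tanh_pole k ^ 2))"
    by (intro summable_mult summable_inverse_tanh_pole_power) auto
  have conv: "uniformly_convergent_on {-A..A} (\<lambda>n y. \<Sum>k<n. 2 * y / (y ^ 2 + tanh_pole k ^ 2))"
    by (rule Weierstrass_m_test'[OF _ summ]) (rule bd)
  have "((\<lambda>y. \<Sum>k. g k y) has_field_derivative (\<Sum>k. 2 * x / (x ^ 2 + tanh_pole k ^ 2))) (at x)"
    by (rule has_field_derivative_series'(2)[where S = "{-A..A}" and f' = "\<lambda>k y. 2 * y / (y ^ 2 + tanh_pole k ^ 2)" and ?x0.0 = x])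
       (use x deriv g_sums conv in \<open>auto simp: sums_iff\<close>)
  moreover have "(\<lambda>y. \<Sum>k. g k y) = (\<lambda>y. ln (cosh y))"
    using g_sums by (auto simp: sums_iff)
  moreover have "((\<lambda>y. ln (cosh y)) has_field_derivative tanh x) (at x)"
    by (auto intro!: derivative_eq_intros simp: tanh_def cosh_real_pos)
  ultimately have "(\<Sum>k. 2 * x / (x ^ 2 + tanh_pole k ^ 2)) = tanh x"
    using DERIV_unique by metis
  moreover have "summable (\<lambda>k. 2 * x / (x ^ 2 + tanh_pole k ^ 2))"
    by (rule summable_comparison_test'[OF summ, of 0]) (use bd x interior_subset in blast)
  ultimately show ?thesis by (simp add: sums_iff)
qed

subsection \<open>Finite parts\<close>

text \<open>
  The cut-off at 0 is \<open>1 / X\<close>, so \<^term>\<open>p\<close> collects the negative powers of the cut-off. Cutting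
  off at \<open>X\<close> as well leaves only integrals over compact intervals.
\<close>
definition has_finite_part :: "(real \<Rightarrow> real) \<Rightarrow> real \<Rightarrow> bool" where
  "has_finite_part F L \<longleftrightarrow>
     (\<exists>p. coeff p 0 = 0 \<and> ((\<lambda>X. F X - poly p X) \<longlongrightarrow> L) at_top)"

abbreviation cut_integral :: "(real \<Rightarrow> real) \<Rightarrow> real \<Rightarrow> real" where
  "cut_integral f X \<equiv> integral {1 / X..X} f"

lemma has_finite_part_tendsto: "(F \<longlongrightarrow> L) at_top \<Longrightarrow> has_finite_part F L"
  unfolding has_finite_part_def by (rule exI[of _ 0]) auto

lemma has_finite_part_power:
  assumes "i \<ge> 1" shows "has_finite_part (\<lambda>X. c * X ^ i) 0"
  unfolding has_finite_part_def
  by (rule exI[of _ "monom c i"]) (use assms in \<open>auto simp: poly_monom\<close>)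

lemma has_finite_part_add:
  assumes "has_finite_part F L" "has_finite_part G M"
  shows "has_finite_part (\<lambda>X. F X + G X) (L + M)"
proof -
  obtain p q where p: "coeff p 0 = 0" "((\<lambda>X. F X - poly p X) \<longlongrightarrow> L) at_top"
    and q: "coeff q 0 = 0" "((\<lambda>X. G X - poly q X) \<longlongrightarrow> M) at_top"
    using assms unfolding has_finite_part_def by auto
  have "((\<lambda>X. F X + G X - poly (p + q) X) \<longlongrightarrow> L + M) at_top"
    using tendsto_add[OF p(2) q(2)] by (simp add: algebra_simps)
  with p q show ?thesis
    unfolding has_finite_part_def by (intro exI[of _ "p + q"]) simp
qed

lemma has_finite_part_cmult:
  assumes "has_finite_part F L"
  shows "has_finite_part (\<lambda>X. c * F X) (c * L)"
proof -
  obtain p where p: "coeff p 0 = 0" "((\<lambda>X. F X - poly p X) \<longlongrightarrow> L) at_top"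
    using assms unfolding has_finite_part_def by auto
  have "((\<lambda>X. c * F X - poly (smult c p) X) \<longlongrightarrow> c * L) at_top"
    using tendsto_mult_left[OF p(2), of c] by (simp add: right_diff_distrib)
  with p show ?thesis
    unfolding has_finite_part_def by (intro exI[of _ "smult c p"]) simp
qed

lemma has_finite_part_sum:
  assumes "\<And>i. i \<in> I \<Longrightarrow> has_finite_part (F i) (L i)"
  shows "has_finite_part (\<lambda>X. \<Sum>i\<in>I. F i X) (\<Sum>i\<in>I. L i)"
  using assms
  by (induction I rule: infinite_finite_induct)
     (auto intro: has_finite_part_add has_finite_part_tendsto)

lemma has_finite_part_cong:
  assumes "has_finite_part F L" "eventually (\<lambda>X. F X = G X) at_top" "L = M"
  shows "has_finite_part G M"
proof -
  obtain p where p: "coeff p 0 = 0" "((\<lambda>X. F X - poly p X) \<longlongrightarrow> L) at_top"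
    using assms(1) unfolding has_finite_part_def by auto
  have "((\<lambda>X. G X - poly p X) \<longlongrightarrow> L) at_top"
    by (rule Lim_transform_eventually[OF p(2)])
       (use assms(2) in \<open>auto elim: eventually_mono\<close>)
  with p(1) assms(3) show ?thesis unfolding has_finite_part_def by auto
qed

text \<open>This turns a finite part back into an ordinary limit. A nonconstant polynomial is
  unbounded, so the subtracted \<open>p\<close> must be constant, and the normalisation
  \<open>coeff p 0 = 0\<close> makes it zero.\<close>

lemma has_finite_part_bounded_imp_tendsto:
  assumes "has_finite_part F L" "eventually (\<lambda>X. norm (F X) \<le> B) at_top"
  shows "(F \<longlongrightarrow> L) at_top"
proof -
  obtain p where p: "coeff p 0 = 0" "((\<lambda>X. F X - poly p X) \<longlongrightarrow> L) at_top"
    using assms(1) unfolding has_finite_part_def by auto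
  have "degree p = 0"
  proof (rule ccontr)
    assume "degree p \<noteq> 0"
    then have "filterlim (poly p) at_infinity at_top"
      using filterlim_poly_at_infinity[of p] at_top_le_at_infinity filterlim_mono by blast
    \<comment> \<open>The bounds on \<open>F\<close> and on \<open>F X - poly p X - L\<close>
      together force norm (poly p X) < B + \<bar>L\<bar> + 1, which this threshold
      contradicts.\<close>
    then have "eventually (\<lambda>X. norm (poly p X) \<ge> B + \<bar>L\<bar> + 2) at_top"
      by (simp add: filterlim_at_infinity_conv_norm_at_top filterlim_at_top)
    moreover have "eventually (\<lambda>X. dist (F X - poly p X) L < 1) at_top"
      using p(2) by (rule tendstoD) auto
    ultimately have "eventually (\<lambda>X::real. False) at_top"
      using assms(2) by eventually_elim (auto simp: dist_norm)
    then show False by simp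
  qed
  then have "p = 0" using p(1) by (auto elim: degree_eq_zeroE)
  then show ?thesis using p(2) by simp
qed

text \<open>The lower end of the antiderivative contributes a multiple of X^(s-1), which the finite
  part discards, and the upper end tends to 0. The condition \<open>s \<ge> 2\<close> excludes the
  logarithm.\<close>

lemma cut_integral_inverse_power:
  assumes "s \<ge> 2" shows "has_finite_part (cut_integral (\<lambda>x. 1 / x ^ s)) 0"
proof -
  define d where "d = s - 2"
  have s: "s = d + 2" using assms by (simp add: d_def)
  define h where "h x = - (1 / real (d + 1)) * inverse x ^ (d + 1)" for x :: real
  have "has_finite_part (\<lambda>X. h X + (1 / real (d + 1)) * X ^ (d + 1)) (0 + 0)"
  proof (intro has_finite_part_add has_finite_part_power has_finite_part_tendsto)
    show "(h \<longlongrightarrow> 0) at_top"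
      unfolding h_def by real_asymp
  qed auto
  then show ?thesis
  proof (rule has_finite_part_cong)
    show "eventually (\<lambda>X. h X + (1 / real (d + 1)) * X ^ (d + 1) = cut_integral (\<lambda>x. 1 / x ^ s) X) at_top"
      using eventually_ge_at_top[of 1]
    proof eventually_elim
      case (elim X)
      have "((\<lambda>x. 1 / x ^ s) has_integral (h X - h (1 / X))) {1 / X..X}"
      proof (rule fundamental_theorem_of_calculus)
        show "1 / X \<le> X" using elim by (simp add: field_simps mult_ge1_I)
        fix x assume "x \<in> {1 / X..X}"
        then have "x > 0" using elim by (auto intro: less_le_trans[of 0 "1 / X"])
        then have "(inverse has_real_derivative - (inverse x ^ 2)) (at x within {1 / X..X})"
          by (auto intro!: derivative_eq_intros simp: power2_eq_square)
        from DERIV_cmult[OF DERIV_power_Suc[OF this, of d], of "- (1 / real (d + 1))"]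
        have "(h has_real_derivative - (1 / real (d + 1)) *
            ((1 + real d) * (- (inverse x ^ 2) * inverse x ^ d))) (at x within {1 / X..X})"
          by (simp add: h_def[abs_def])
        moreover have "- (1 / real (d + 1)) * ((1 + real d) * (- (inverse x ^ 2) * inverse x ^ d)) =
            inverse x ^ s"
          using add_pos_nonneg[of 1 "real d"] by (simp add: s power2_eq_square add.commute)
        ultimately have "(h has_real_derivative inverse x ^ s) (at x within {1 / X..X})"
          by metis
        then show "(h has_vector_derivative 1 / x ^ s) (at x within {1 / X..X})"
          by (simp add: has_real_derivative_iff_has_vector_derivative inverse_eq_divide power_one_over)
      qed
      then show ?case by (simp add: integral_unique h_def power_divide)
    qed
  qed auto
qed

lemma integrable_on_cut:
  fixes f :: "real \<Rightarrow> real"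
  assumes "continuous_on {0<..} f" "X > 0"
  shows "f integrable_on {1 / X..X}"
  using assms by (intro integrable_continuous_real continuous_on_subset[OF assms(1)])
    (auto intro: less_le_trans[of 0 "1 / X"])

lemma cut_integral_cong:
  assumes "\<And>x. x > 0 \<Longrightarrow> f x = g x" "X > 0"
  shows "cut_integral f X = cut_integral g X"
  using assms by (intro integral_cong assms(1)) (auto intro: less_le_trans[of 0 "1 / X"])

lemma cut_integral_lincomb:
  assumes "continuous_on {0<..} f" "continuous_on {0<..} g"
    and "has_finite_part (cut_integral f) L" "has_finite_part (cut_integral g) M"
    and "\<And>x. x > 0 \<Longrightarrow> h x = a * f x + b * g x"
  shows "has_finite_part (cut_integral h) (a * L + b * M)"
proof -
  have "has_finite_part (\<lambda>X. a * cut_integral f X + b * cut_integral g X) (a * L + b * M)"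
    using assms by (intro has_finite_part_add has_finite_part_cmult)
  then show ?thesis
  proof (rule has_finite_part_cong)
    show "eventually (\<lambda>X. a * cut_integral f X + b * cut_integral g X = cut_integral h X) at_top"
      using eventually_gt_at_top[of 0]
    proof eventually_elim
      case (elim X)
      have "cut_integral h X = cut_integral (\<lambda>x. a * f x + b * g x) X"
        using elim by (intro cut_integral_cong assms(5))
      also have "\<dots> = a * cut_integral f X + b * cut_integral g X"
        using integrable_on_cut[OF assms(1) elim] integrable_on_cut[OF assms(2) elim]
        by (simp add: integral_add integrable_on_mult_right)
      finally show ?case by simp
    qed
  qed simp
qed

subsection \<open>The finite part of \<open>tanh x / x ^ s\<close>\<close>

text \<open>
  Successive remainders of the expansion of \<^term>\<open>tanh x / x\<close> in powers of \<^term>\<open>x ^ 2\<close>.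
\<close>
definition tanh_tail :: "nat \<Rightarrow> real \<Rightarrow> real" where
  "tanh_tail d x = (\<Sum>k. 2 / (tanh_pole k ^ (2 * d) * (x ^ 2 + tanh_pole k ^ 2)))"

lemma pole_denominator_pos [simp]: "x ^ 2 + tanh_pole k ^ 2 > 0"
  by (intro add_nonneg_pos) auto

lemma pole_denominator_nonzero [simp]: "x ^ 2 + tanh_pole k ^ 2 \<noteq> 0"
  using pole_denominator_pos[of x k] by linarith

lemma tanh_tail_term_le:
  "norm (2 / (tanh_pole k ^ (2 * d) * (x ^ 2 + tanh_pole k ^ 2))) \<le> 2 * (1 / tanh_pole k ^ (2 * d + 2))"
proof -
  have "tanh_pole k ^ (2 * d + 2) = tanh_pole k ^ (2 * d) * tanh_pole k ^ 2"
    by (simp add: power_add power2_eq_square)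
  also have "\<dots> \<le> tanh_pole k ^ (2 * d) * (x ^ 2 + tanh_pole k ^ 2)"
    by (intro mult_left_mono) auto
  finally have "2 / (tanh_pole k ^ (2 * d) * (x ^ 2 + tanh_pole k ^ 2)) \<le> 2 / tanh_pole k ^ (2 * d + 2)"
    by (intro divide_left_mono) auto
  then show ?thesis by (simp add: abs_of_pos)
qed

lemma summable_tanh_tail_bound: "summable (\<lambda>k. 2 * (1 / tanh_pole k ^ (2 * d + 2)))"
  by (intro summable_mult summable_inverse_tanh_pole_power) auto

lemma summable_tanh_tail:
  "summable (\<lambda>k. 2 / (tanh_pole k ^ (2 * d) * (x ^ 2 + tanh_pole k ^ 2)))"
  by (rule summable_comparison_test'[OF summable_tanh_tail_bound, of 0]) (rule tanh_tail_term_le)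

lemma uniform_limit_tanh_tail:
  "uniform_limit A (\<lambda>n x. \<Sum>k<n. 2 / (tanh_pole k ^ (2 * d) * (x ^ 2 + tanh_pole k ^ 2)))
     (tanh_tail d) sequentially"
  using Weierstrass_m_test[OF tanh_tail_term_le summable_tanh_tail_bound]
  unfolding tanh_tail_def[abs_def] .

lemma continuous_on_tanh_tail: "continuous_on A (tanh_tail d)"
  by (rule uniform_limit_theorem[OF _ uniform_limit_tanh_tail])
     (auto intro!: always_eventually continuous_intros)

lemma tanh_conv_tail: "tanh x = x * tanh_tail 0 x"
proof -
  have "x * tanh_tail 0 x = (\<Sum>k. x * (2 / (tanh_pole k ^ (2 * 0) * (x ^ 2 + tanh_pole k ^ 2))))"
    unfolding tanh_tail_def by (rule suminf_mult[symmetric, OF summable_tanh_tail])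
  also have "\<dots> = (\<Sum>k. 2 * x / (x ^ 2 + tanh_pole k ^ 2))" by (simp add: mult.commute)
  also have "\<dots> = tanh x" using sums_tanh[of x] by (simp add: sums_iff)
  finally show ?thesis ..
qed

lemma tanh_tail_Suc:
  "tanh_tail d x = (\<Sum>k. 2 / tanh_pole k ^ (2 * d + 2)) - x ^ 2 * tanh_tail (Suc d) x"
proof -
  have "2 / (tanh_pole k ^ (2 * d) * (x ^ 2 + tanh_pole k ^ 2)) =
      2 / tanh_pole k ^ (2 * d + 2) - x ^ 2 * (2 / (tanh_pole k ^ (2 * Suc d) * (x ^ 2 + tanh_pole k ^ 2)))"
    for k
    by (simp add: divide_simps power_add) (simp add: algebra_simps power2_eq_square)
  then have "tanh_tail d x = (\<Sum>k. 2 / tanh_pole k ^ (2 * d + 2) -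
      x ^ 2 * (2 / (tanh_pole k ^ (2 * Suc d) * (x ^ 2 + tanh_pole k ^ 2))))"
    by (simp add: tanh_tail_def)
  also have "\<dots> = (\<Sum>k. 2 / tanh_pole k ^ (2 * d + 2)) -
      (\<Sum>k. x ^ 2 * (2 / (tanh_pole k ^ (2 * Suc d) * (x ^ 2 + tanh_pole k ^ 2))))"
    using summable_tanh_tail_bound[of d]
    by (intro suminf_diff[symmetric] summable_mult summable_tanh_tail) simp
  also have "(\<Sum>k. x ^ 2 * (2 / (tanh_pole k ^ (2 * Suc d) * (x ^ 2 + tanh_pole k ^ 2)))) =
      x ^ 2 * tanh_tail (Suc d) x"
    unfolding tanh_tail_def by (rule suminf_mult[OF summable_tanh_tail])
  finally show ?thesis .
qed

text \<open>Each summand has an arctan antiderivative whose increment tends to pi / 2. Uniform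
  convergence exchanges sum and integral on the cut interval, and Tannery's theorem exchanges sum
  and limit; its majorant, a multiple of 1 / \<open>tanh_pole k ^ (2 * d + 1)\<close>, is summable
  because d \<ge> 1.\<close>

lemma tanh_tail_integral_tendsto:
  assumes "d \<ge> 1"
  shows "(cut_integral (tanh_tail d) \<longlongrightarrow> (\<Sum>k. pi / tanh_pole k ^ (2 * d + 1))) at_top"
proof -
  define A where "A k X = 2 / tanh_pole k ^ (2 * d + 1) *
    (arctan (X / tanh_pole k) - arctan (1 / X / tanh_pole k))" for k X
  have A_int: "((\<lambda>x. 2 / (tanh_pole k ^ (2 * d) * (x ^ 2 + tanh_pole k ^ 2))) has_integral A k X)
      {1 / X..X}" if "X \<ge> 1" for k X
  proof -
    define h where "h x = 2 / tanh_pole k ^ (2 * d + 1) * arctan (x / tanh_pole k)" for x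
    have "1 / X \<le> X" using that by (simp add: field_simps mult_ge1_I)
    moreover have "(h has_real_derivative 2 / (tanh_pole k ^ (2 * d) * (x ^ 2 + tanh_pole k ^ 2)))
        (at x within {1 / X..X})" for x
    proof -
      have "1 + (x / tanh_pole k) ^ 2 = (x ^ 2 + tanh_pole k ^ 2) / tanh_pole k ^ 2"
        by (simp add: add_divide_distrib power_divide)
      moreover have "(h has_real_derivative
          2 / tanh_pole k ^ (2 * d + 1) * (1 / tanh_pole k / (1 + (x / tanh_pole k) ^ 2)))
          (at x within {1 / X..X})"
        unfolding h_def by (auto intro!: derivative_eq_intros simp: divide_simps)
      ultimately show ?thesis
        by (simp add: power2_eq_square)
    qed
    ultimately show ?thesis
      using fundamental_theorem_of_calculus[of "1 / X" X h
          "\<lambda>x. 2 / (tanh_pole k ^ (2 * d) * (x ^ 2 + tanh_pole k ^ 2))"]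
      by (simp add: has_real_derivative_iff_has_vector_derivative A_def h_def right_diff_distrib)
  qed
  have cut: "cut_integral (tanh_tail d) X = (\<Sum>k. A k X)" if X: "X \<ge> 1" for X
  proof -
    obtain I J where IJ:
      "\<And>n. ((\<lambda>x. \<Sum>k<n. 2 / (tanh_pole k ^ (2 * d) * (x ^ 2 + tanh_pole k ^ 2))) has_integral I n) {1 / X..X}"
      "(tanh_tail d has_integral J) {1 / X..X}" "I \<longlonglongrightarrow> J"
      by (rule uniform_limit_integral[OF uniform_limit_tanh_tail, of "1 / X" X d])
         (auto intro!: continuous_intros)
    have "I = (\<lambda>n. \<Sum>k<n. A k X)"
      by (rule ext, rule has_integral_unique[OF IJ(1) has_integral_sum]) (use A_int[OF X] in auto)
    then have "(\<lambda>k. A k X) sums J" using IJ(3) by (simp add: sums_def)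
    then show ?thesis using IJ(2) by (simp add: sums_iff integral_unique)
  qed
  have "((\<lambda>X. \<Sum>k. A k X) \<longlongrightarrow> (\<Sum>k. pi / tanh_pole k ^ (2 * d + 1))) at_top"
  proof (rule conjunct2[OF conjunct2[OF tannerys_theorem]])
    show "((\<lambda>X. A k X) \<longlongrightarrow> pi / tanh_pole k ^ (2 * d + 1)) at_top" for k
    proof -
      have 1: "LIM X at_top. X / tanh_pole k :> at_top"
        using tanh_pole_pos[of k] by real_asymp
      have 2: "((\<lambda>X. 1 / X / tanh_pole k) \<longlongrightarrow> 0) at_top"
        using tanh_pole_pos[of k] by real_asymp
      have "((\<lambda>X. A k X) \<longlongrightarrow> 2 / tanh_pole k ^ (2 * d + 1) * (pi / 2 - arctan 0)) at_top"
        unfolding A_def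
        by (intro tendsto_intros filterlim_compose[OF tendsto_arctan_at_top 1] 2)
      then show ?thesis by simp
    qed
    have "norm (A k X) \<le> 2 * pi * (1 / tanh_pole k ^ (2 * d + 1))" for k X
    proof -
      have "\<bar>arctan (X / tanh_pole k) - arctan (1 / X / tanh_pole k)\<bar> \<le> pi"
        using arctan_bounded[of "X / tanh_pole k"] arctan_bounded[of "1 / X / tanh_pole k"]
        by linarith
      then have "2 / tanh_pole k ^ (2 * d + 1) *
          \<bar>arctan (X / tanh_pole k) - arctan (1 / X / tanh_pole k)\<bar> \<le>
          2 / tanh_pole k ^ (2 * d + 1) * pi"
        by (intro mult_left_mono divide_nonneg_pos zero_less_power) auto
      moreover have "norm (A k X) = 2 / tanh_pole k ^ (2 * d + 1) *
          \<bar>arctan (X / tanh_pole k) - arctan (1 / X / tanh_pole k)\<bar>"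
        unfolding A_def real_norm_def abs_mult by (simp only: abs_divide) (simp add: abs_of_pos)
      ultimately show ?thesis by (simp only:) (simp add: mult.commute)
    qed
    then show "eventually (\<lambda>(k, X). norm (A k X) \<le> 2 * pi * (1 / tanh_pole k ^ (2 * d + 1)))
        (at_top \<times>\<^sub>F at_top)"
      by (intro always_eventually) auto
    show "summable (\<lambda>k. 2 * pi * (1 / tanh_pole k ^ (2 * d + 1)))"
      using assms by (intro summable_mult summable_inverse_tanh_pole_power) auto
  qed auto
  then show ?thesis
    by (rule Lim_transform_eventually)
       (use eventually_ge_at_top[of 1] in \<open>eventually_elim, auto simp: cut\<close>)
qed

text \<open>Each use of \<open>tanh_tail_Suc\<close> splits off a pure inverse power, of finite part
  0, and trades a factor x^(-2) for one more step in \<open>d\<close> and a change of sign. The sum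
  d + q is invariant, so the descent ends at q = 0 in the convergent case.\<close>

lemma tanh_tail_finite_part:
  assumes "d + q \<ge> 1"
  shows "has_finite_part (cut_integral (\<lambda>x. tanh_tail d x / x ^ (2 * q)))
    ((-1) ^ q * (\<Sum>k. pi / tanh_pole k ^ (2 * (d + q) + 1)))"
  using assms
proof (induction q arbitrary: d)
  case 0
  then show ?case using tanh_tail_integral_tendsto[of d]
    by (auto intro: has_finite_part_tendsto)
next
  case (Suc q)
  have "has_finite_part (cut_integral (\<lambda>x. tanh_tail d x / x ^ (2 * Suc q)))
    ((\<Sum>k. 2 / tanh_pole k ^ (2 * d + 2)) * 0 +
     (-1) * ((-1) ^ q * (\<Sum>k. pi / tanh_pole k ^ (2 * (Suc d + q) + 1))))"
  proof (rule cut_integral_lincomb)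
    show "has_finite_part (cut_integral (\<lambda>x. tanh_tail (Suc d) x / x ^ (2 * q)))
      ((- 1) ^ q * (\<Sum>k. pi / tanh_pole k ^ (2 * (Suc d + q) + 1)))"
      by (rule Suc.IH) auto
    show "has_finite_part (cut_integral (\<lambda>x. 1 / x ^ (2 * Suc q))) 0"
      by (rule cut_integral_inverse_power) auto
    show "tanh_tail d x / x ^ (2 * Suc q) = (\<Sum>k. 2 / tanh_pole k ^ (2 * d + 2)) * (1 / x ^ (2 * Suc q))
        + (-1) * (tanh_tail (Suc d) x / x ^ (2 * q))" if "x > 0" for x
      using that by (subst tanh_tail_Suc) (simp add: diff_divide_distrib power2_eq_square)
  qed (auto intro!: continuous_intros continuous_on_tanh_tail)
  then show ?case by (simp add: algebra_simps)
qed

section \<open>Odd zeta values from the poles of tanh\<close>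

lemma zeta_sums:
  assumes "e \<ge> 2" shows "(\<lambda>k. 1 / real (Suc k) ^ e) sums zeta (real e)"
proof -
  have "summable (\<lambda>k. inverse (real (Suc k) ^ e))"
    using inverse_power_summable[OF assms, where ?'a = real] by (subst summable_Suc_iff)
  then show ?thesis
    by (simp add: zeta_def powr_realpow inverse_eq_divide sums_iff)
qed

text \<open>The poles are odd multiples of pi / 2, so this is a sum over odd integers. Grouping the
  zeta series in pairs separates the even integers, which contribute zeta (e) / 2^e.\<close>

lemma tanh_pole_power_sum:
  assumes "q \<ge> 1"
  shows "(\<Sum>k. pi / tanh_pole k ^ (2 * q + 1)) =
    (2 ^ (2 * q + 1) - 1) * (zeta (real (2 * q + 1)) / pi ^ (2 * q))"
proof -
  define e where "e = 2 * q + 1"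
  define Z where "Z = zeta (real e)"
  have Z: "(\<lambda>k. 1 / real (Suc k) ^ e) sums Z"
    unfolding Z_def using assms by (intro zeta_sums) (auto simp: e_def)
  have "(\<lambda>j. 1 / (2 * real j + 1) ^ e + 1 / 2 ^ e * (1 / real (Suc j) ^ e)) sums Z"
  proof -
    have "(\<lambda>j. \<Sum>k=j * 2..<j * 2 + 2. 1 / real (Suc k) ^ e) sums Z"
      by (rule sums_group[OF Z]) auto
    moreover have "(\<Sum>k=j * 2..<j * 2 + 2. 1 / real (Suc k) ^ e) =
        1 / (2 * real j + 1) ^ e + 1 / 2 ^ e * (1 / real (Suc j) ^ e)" for j
    proof -
      have "{j * 2..<j * 2 + 2} = {j * 2, j * 2 + 1}" by auto
      then have "(\<Sum>k=j * 2..<j * 2 + 2. 1 / real (Suc k) ^ e) =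
          1 / real (Suc (j * 2)) ^ e + 1 / real (Suc (j * 2 + 1)) ^ e" by simp
      also have "real (Suc (j * 2 + 1)) = 2 * real (Suc j)" by simp
      also have "real (Suc (j * 2)) = 2 * real j + 1" by simp
      finally show ?thesis by (simp only: power_mult_distrib) simp
    qed
    ultimately show ?thesis by simp
  qed
  from sums_diff[OF this sums_mult[OF Z, of "1 / 2 ^ e"]]
  have "(\<lambda>j. 1 / (2 * real j + 1) ^ e) sums (Z - 1 / 2 ^ e * Z)" by simp
  from sums_mult[OF this, of "pi * (2 / pi) ^ e"]
  have "(\<lambda>j. pi / tanh_pole j ^ e) sums (pi * (2 / pi) ^ e * (Z - 1 / 2 ^ e * Z))"
    by (simp add: tanh_pole_def power_divide power_mult_distrib mult_ac)
  moreover have "pi * (2 / pi) ^ e * (Z - 1 / 2 ^ e * Z) = (2 ^ e - 1) * (Z / pi ^ (2 * q))"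
    by (simp add: power_divide field_simps e_def)
  ultimately show ?thesis by (simp add: sums_iff e_def Z_def)
qed

lemma tanh_finite_part:
  assumes "q \<ge> 1"
  shows "has_finite_part (cut_integral (\<lambda>x. tanh x / x ^ (2 * q + 1)))
    ((-1) ^ q * ((2 ^ (2 * q + 1) - 1) * (zeta (real (2 * q + 1)) / pi ^ (2 * q))))"
proof -
  have "has_finite_part (cut_integral (\<lambda>x. tanh_tail 0 x / x ^ (2 * q)))
    ((-1) ^ q * ((2 ^ (2 * q + 1) - 1) * (zeta (real (2 * q + 1)) / pi ^ (2 * q))))"
    using tanh_tail_finite_part[of 0 q] tanh_pole_power_sum[OF assms] assms by simp
  then show ?thesis
    by (rule has_finite_part_cong)
       (auto intro!: eventually_mono[OF eventually_gt_at_top[of 0]] cut_integral_cong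
         simp: tanh_conv_tail[abs_def])
qed

subsection \<open>Recurrence for the finite parts\<close>

text \<open>Taylor's formula with Peano remainder, by induction on \<open>s\<close>: the remainder
  of order s + 1 of \<open>f\<close> is that of order s of the difference quotient (f y - f 0) /
  y.\<close>

lemma has_fps_expansion_remainder:
  fixes f :: "real \<Rightarrow> real"
  assumes "f has_fps_expansion F"
  shows "((\<lambda>y. (f y - (\<Sum>i\<le>s. fps_nth F i * y ^ i)) / y ^ s) \<longlongrightarrow> 0) (at 0)"
  using assms
proof (induction s arbitrary: f F)
  case 0
  have "f \<midarrow>0\<rightarrow> f 0"
    using has_fps_expansion_imp_continuous[OF 0, of UNIV] by (simp add: continuous_within)
  moreover have "f 0 = fps_nth F 0"
    using 0 by (auto simp: has_fps_expansion_def eval_fps_at_0 dest: eventually_nhds_x_imp_x)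
  ultimately show ?case by (simp add: LIM_zero)
next
  case (Suc s)
  define H where "H = F - fps_const (fps_nth F 0)"
  define g where "g y = (if y = 0 then fps_nth H 1 else (f y - fps_nth F 0) / y ^ 1)" for y
  have "g has_fps_expansion fps_shift 1 H"
  \<comment> \<open>For \<open>H = 0\<close> the subdegree is 0, so the shift rule with exponent 1
    does not apply and the expansion is obtained directly.\<close>
  proof (cases "H = 0")
    case True
    then have "(\<lambda>y. f y - fps_nth F 0) has_fps_expansion 0"
      using has_fps_expansion_diff[OF Suc.prems has_fps_expansion_const[of "fps_nth F 0"]]
      by (simp add: H_def)
    then have "eventually (\<lambda>y. f y - fps_nth F 0 = 0) (nhds 0)"
      by (simp add: has_fps_expansion_0_iff)
    then have "eventually (\<lambda>y. g y = 0) (nhds 0)"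
      by eventually_elim (simp add: g_def True)
    then show ?thesis using True by (simp add: has_fps_expansion_0_iff)
  next
    case False
    then show ?thesis
      unfolding g_def H_def
      by (intro has_fps_expansion_shift has_fps_expansion_diff Suc.prems has_fps_expansion_const
          subdegree_geI) auto
  qed
  from Suc.IH[OF this] show ?case
  proof (rule Lim_transform_eventually)
    show "eventually (\<lambda>y. (g y - (\<Sum>i\<le>s. fps_nth (fps_shift 1 H) i * y ^ i)) / y ^ s =
        (f y - (\<Sum>i\<le>Suc s. fps_nth F i * y ^ i)) / y ^ Suc s) (at 0)"
      using eventually_neq_at_within[of 0 0 UNIV]
    proof eventually_elim
      case (elim y)
      have "(\<Sum>i\<le>Suc s. fps_nth F i * y ^ i) =
          fps_nth F 0 + y * (\<Sum>i\<le>s. fps_nth (fps_shift 1 H) i * y ^ i)"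
        by (subst sum.atMost_Suc_shift) (simp add: H_def sum_distrib_left mult_ac)
      then show ?case using elim by (simp add: g_def divide_simps)
    qed
  qed
qed

text \<open>Existence of an expansion suffices: parity is taken later from
  \<open>tanh_minus\<close>, not from the coefficients.\<close>

lemma has_fps_expansion_tanh: "\<exists>F. (tanh :: real \<Rightarrow> real) has_fps_expansion F"
proof -
  have "(\<lambda>x::real. (exp (1 * x) - exp (- 1 * x)) / (exp (1 * x) + exp (- 1 * x))) has_fps_expansion
      ((fps_exp 1 - fps_exp (-1)) / (fps_exp 1 + fps_exp (-1)))"
    by (intro fps_expansion_intros) auto
  then show ?thesis by (auto simp: tanh_altdef[abs_def])
qed

text \<open>Only powers of the parity of \<^term>\<open>k\<close> survive in \<^term>\<open>tanh (1 / X) ^ k\<close>, so there is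
  no constant term.\<close>
lemma tanh_power_boundary:
  assumes "odd (k + s)"
  shows "has_finite_part (\<lambda>X. tanh (1 / X) ^ k * X ^ s) 0"
proof -
  obtain F where "(tanh :: real \<Rightarrow> real) has_fps_expansion F"
    using has_fps_expansion_tanh by auto
  then have "(\<lambda>y::real. tanh y ^ k) has_fps_expansion F ^ k"
    by (rule has_fps_expansion_power)
  define c where "c i = fps_nth (F ^ k) i" for i
  define D where "D y = (tanh y ^ k - (\<Sum>i\<le>s. c i * y ^ i)) / y ^ s" for y :: real
  have D: "(D \<longlongrightarrow> 0) (at 0)"
    unfolding D_def c_def by (rule has_fps_expansion_remainder) fact
  have "((\<lambda>X. D (1 / X)) \<longlongrightarrow> 0) at_top"
    by (rule filterlim_compose[OF D]) real_asymp
  moreover have "((\<lambda>X. D (- (1 / X))) \<longlongrightarrow> 0) at_top"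
    by (rule filterlim_compose[OF D]) real_asymp
  ultimately have lim: "((\<lambda>X. (D (1 / X) - D (- (1 / X))) / 2) \<longlongrightarrow> 0) at_top"
    by (auto intro!: tendsto_eq_intros)
  \<comment> \<open>As \<open>k + s\<close> is odd, tanh^k y / y^s is an odd function of y, so half
    the difference of \<open>D\<close> at 1 / X and - 1 / X still contains all of it. The
    coefficients \<open>c'\<close> are what remains of the Taylor terms; \<open>c' s = 0\<close>, so
    only positive powers of X occur.\<close>
  define c' where "c' i = c i * (1 - (-1) ^ (s + i)) / 2" for i
  have eq: "(D (1 / X) - D (- (1 / X))) / 2 + (\<Sum>i<s. c' i * X ^ (s - i)) = tanh (1 / X) ^ k * X ^ s"
    if "X > 0" for X
  proof -
    define y where "y = 1 / X"
    have y: "y > 0" "X = 1 / y" using that by (auto simp: y_def)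
    have tanh: "tanh (- y) ^ k = (-1) ^ k * tanh y ^ k"
      by (metis mult_minus1 power_mult_distrib tanh_minus)
    have sgn: "(-1) ^ s * (-1) ^ k = (-1 :: real)"
      using assms by (simp flip: power_add add: add.commute)
    have y': "(- y) ^ i = (-1) ^ i * y ^ i" for i by (rule power_minus)
    have "D (- y) = (-1) ^ s * (((-1) ^ k * tanh y ^ k - (\<Sum>i\<le>s. c i * ((-1) ^ i * y ^ i))) / y ^ s)"
      unfolding D_def tanh y' by (cases "even s") (auto simp: minus_divide_left)
    also have "\<dots> = (((-1) ^ s * (-1) ^ k) * tanh y ^ k - (\<Sum>i\<le>s. c i * (-1) ^ (s + i) * y ^ i)) / y ^ s"
      by (simp add: right_diff_distrib sum_distrib_left power_add mult_ac)
    finally have "D (- y) = (- (tanh y ^ k) - (\<Sum>i\<le>s. c i * (-1) ^ (s + i) * y ^ i)) / y ^ s"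
      unfolding sgn by simp
    then have "(D y - D (- y)) / 2 =
        (2 * tanh y ^ k - ((\<Sum>i\<le>s. c i * y ^ i) - (\<Sum>i\<le>s. c i * (-1) ^ (s + i) * y ^ i))) / y ^ s / 2"
      by (simp add: D_def flip: diff_divide_distrib)
    also have "(\<Sum>i\<le>s. c i * y ^ i) - (\<Sum>i\<le>s. c i * (-1) ^ (s + i) * y ^ i) =
        2 * (\<Sum>i\<le>s. c' i * y ^ i)"
      by (simp add: c'_def sum_distrib_left flip: sum_subtractf) (simp add: algebra_simps)
    also have "(\<Sum>i\<le>s. c' i * y ^ i) = (\<Sum>i<s. c' i * y ^ i)"
      by (simp add: c'_def flip: lessThan_Suc_atMost)
    finally have "(D y - D (- y)) / 2 = tanh y ^ k / y ^ s - (\<Sum>i<s. c' i * y ^ i) / y ^ s"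
      by (simp add: diff_divide_distrib)
    also have "(\<Sum>i<s. c' i * y ^ i) / y ^ s = (\<Sum>i<s. c' i * X ^ (s - i))"
      unfolding sum_divide_distrib
      using y by (intro sum.cong refl) (simp add: power_divide power_diff)
    also have "tanh y ^ k / y ^ s = tanh y ^ k * X ^ s"
      by (simp add: y_def power_divide)
    finally show ?thesis unfolding y_def by linarith
  qed
  have "has_finite_part (\<lambda>X. (D (1 / X) - D (- (1 / X))) / 2 + (\<Sum>i<s. c' i * X ^ (s - i)))
      (0 + (\<Sum>i<s. 0))"
    by (intro has_finite_part_add has_finite_part_tendsto[OF lim] has_finite_part_sum
        has_finite_part_power) auto
  then show ?thesis
    by (rule has_finite_part_cong) (auto intro!: eventually_mono[OF eventually_gt_at_top[of 0]] eq)
qed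

text \<open>Since tanh' = 1 - tanh^2, the derivative of tanh^k x / x^s combines exactly the three
  integrands. Its cut integral has finite part 0: the boundary term at X tends to 0, and the one at
  1 / X is covered by \<open>tanh_power_boundary\<close>.\<close>

lemma tanh_power_finite_part_step:
  assumes "k \<ge> 1" "s \<ge> 1" "odd (k + s)"
    and L: "has_finite_part (cut_integral (\<lambda>x. tanh x ^ (k - 1) / x ^ s)) L"
    and M: "has_finite_part (cut_integral (\<lambda>x. tanh x ^ k / x ^ (s + 1))) M"
  shows "has_finite_part (cut_integral (\<lambda>x. tanh x ^ (k + 1) / x ^ s)) (L - real s / real k * M)"
proof -
  define h where "h x = tanh x ^ k / x ^ s" for x :: real
  define h' where "h' x = real k * (tanh x ^ (k - 1) / x ^ s - tanh x ^ (k + 1) / x ^ s)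
    - real s * (tanh x ^ k / x ^ (s + 1))" for x :: real
  have h: "(h has_real_derivative h' x) (at x within A)" if "x > 0" for x A
  proof -
    obtain l where l: "k = Suc l" using assms(1) by (cases k) auto
    obtain t where t: "s = Suc t" using assms(2) by (cases s) auto
    have "(tanh has_real_derivative 1 - tanh x ^ 2) (at x within A)"
      by (auto intro!: derivative_eq_intros simp: cosh_real_nonzero)
    from DERIV_divide[OF DERIV_power_Suc[OF this, of l] DERIV_power_Suc[OF DERIV_ident, of t]]
    have "(h has_real_derivative ((1 + real l) * ((1 - tanh x ^ 2) * tanh x ^ l) * x ^ Suc t
        - tanh x ^ Suc l * ((1 + real t) * (1 * x ^ t))) / (x ^ Suc t * x ^ Suc t)) (at x within A)"
      using that by (simp add: h_def[abs_def] l t)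
    moreover have "((1 + real l) * ((1 - tanh x ^ 2) * tanh x ^ l) * x ^ Suc t
        - tanh x ^ Suc l * ((1 + real t) * (1 * x ^ t))) / (x ^ Suc t * x ^ Suc t) = h' x"
      using that by (simp add: h'_def l t divide_simps) (simp add: algebra_simps power2_eq_square)
    ultimately show ?thesis by simp
  qed
  have cont: "continuous_on {0<..} (\<lambda>x::real. tanh x ^ i / x ^ j)" for i j
    by (auto intro!: continuous_intros simp: cosh_real_nonzero)
  have "has_finite_part (\<lambda>X. h X + (-1) * (tanh (1 / X) ^ k * X ^ s)) (0 + (-1) * 0)"
  proof (intro has_finite_part_add has_finite_part_cmult tanh_power_boundary
      has_finite_part_tendsto assms(3))
    have "((\<lambda>X::real. tanh X ^ k * inverse X ^ s) \<longlongrightarrow> 1 ^ k * 0 ^ s) at_top"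
      by (intro tendsto_intros tanh_real_at_top tendsto_inverse_0_at_top filterlim_ident)
    then show "(h \<longlongrightarrow> 0) at_top"
      using assms(2) by (simp add: h_def[abs_def] field_simps power_0_left)
  qed
  then have h'_fp: "has_finite_part (cut_integral h') 0"
  proof (rule has_finite_part_cong)
    show "eventually (\<lambda>X. h X + (-1) * (tanh (1 / X) ^ k * X ^ s) = cut_integral h' X) at_top"
      using eventually_ge_at_top[of 1]
    proof eventually_elim
      case (elim X)
      have "(h' has_integral (h X - h (1 / X))) {1 / X..X}"
        using elim
        by (intro fundamental_theorem_of_calculus)
           (auto intro!: h[unfolded has_real_derivative_iff_has_vector_derivative]
             intro: less_le_trans[of 0 "1 / X"] simp: field_simps mult_ge1_I)
      then show ?case by (simp add: integral_unique) (simp add: h_def power_divide)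
    qed
  qed auto
  \<comment> \<open>\<open>cut_integral_lincomb\<close> combines two functions at a time, so the two
    known integrands are merged into \<open>g\<close> before \<open>h'\<close> is brought
    in.\<close>
  define g where "g x = 1 * (tanh x ^ (k - 1) / x ^ s) + (- (real s / real k)) * (tanh x ^ k / x ^ (s + 1))"
    for x :: real
  have "has_finite_part (cut_integral g) (1 * L + (- (real s / real k)) * M)"
    by (rule cut_integral_lincomb[OF cont cont L M]) (simp add: g_def)
  then have "has_finite_part (cut_integral (\<lambda>x. tanh x ^ (k + 1) / x ^ s))
      (1 * (1 * L + (- (real s / real k)) * M) + (- (1 / real k)) * 0)"
  proof (rule cut_integral_lincomb[rotated 2])
    show "continuous_on {0<..} g"
      unfolding g_def by (intro continuous_intros cont)
    show "continuous_on {0<..} h'"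
      unfolding h'_def by (intro continuous_intros cont)
    show "tanh x ^ (k + 1) / x ^ s = 1 * g x + (- (1 / real k)) * h' x" if "x > 0" for x
      using that assms(1) by (simp add: g_def h'_def field_simps)
  qed (rule h'_fp)
  then show ?thesis by simp
qed

section \<open>The closed form of the finite parts and its recurrence\<close>

definition zeta_term :: "nat \<Rightarrow> real" where
  "zeta_term p = (2 ^ (2 * p + 1) - 1) * (zeta (real (2 * p + 1)) / pi ^ (2 * p))"

text \<open>
  The sign is $(-1)^{(k-s)/2}$; adding $2s$ to the exponent avoids truncated subtraction. The sum
  may start at 0, as the binomial coefficient vanishes for \<open>2 * p < s - 1\<close>.
\<close>
definition tanh_value :: "nat \<Rightarrow> nat \<Rightarrow> real" where
  "tanh_value k s = (-1) ^ ((k + 3 * s) div 2) *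
     (\<Sum>p\<le>(k + s) div 2 - 1. real ((2 * p) choose (s - 1)) * zeta_term p * ucot_coeff k (k + s - 2 - 2 * p))"

lemma binomial_step_real: "real (Suc k) * real (n choose Suc k) = (real n - real k) * real (n choose k)"
proof (cases "k \<le> n")
  case True
  have "Suc k * (n choose Suc k) = (n - k) * (n choose k)"
    by (metis binomial_absorption binomial_absorb_comp)
  then have "real (Suc k * (n choose Suc k)) = real ((n - k) * (n choose k))" by simp
  then show ?thesis using True by (simp only: of_nat_mult of_nat_diff)
qed (simp add: binomial_eq_0)

text \<open>The closed form obeys the recurrence of the finite parts. In
  \<open>ucot_coeff_recurrence\<close> with r = l + s - 1 - 2 p, the factor l - r equals 2 p - (s -
  1), and this turns the binomial with lower index s - 1 into s times the one with lower index s.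
  The sums therefore match term by term in p.\<close>

lemma tanh_value_step:
  assumes "l \<ge> 1" "s \<ge> 2" "odd (l + s)"
  shows "tanh_value (l + 1) s = tanh_value (l - 1) s - real s / real l * tanh_value l (s + 1)"
proof -
  obtain e where e: "l + s = 2 * e + 1" using assms(3) by (elim oddE)
  have "e \<ge> 1" using e assms by simp
  then obtain d where d: "e = Suc d" by (cases e) auto
  define b where "b t p = real ((2 * p) choose t) * zeta_term p" for t p
  define \<sigma> where "\<sigma> = (l + 1 + 3 * s) div 2"
  define A where "A = (\<Sum>p\<le>e. b (s - 1) p * ucot_coeff (l + 1) (2 * e - 2 * p))"
  define B where "B = (\<Sum>p\<le>d. b (s - 1) p * ucot_coeff (l - 1) (2 * d - 2 * p))"
  define C where "C = (\<Sum>p\<le>e. b s p * ucot_coeff l (2 * e - 2 * p))"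
  have b: "(real (2 * p) - real (s - 1)) * b (s - 1) p = real s * b s p" for p
    using binomial_step_real[of "s - 1" "2 * p"] assms(2) by (simp add: b_def)
  have "real l * A = real s * C - real l * B"
  proof -
    have "real l * (b (s - 1) p * ucot_coeff (l + 1) (2 * e - 2 * p)) =
        real s * (b s p * ucot_coeff l (2 * e - 2 * p)) -
        real l * (b (s - 1) p * ucot_coeff (l - 1) (2 * d - 2 * p))" if "p \<le> d" for p
    proof -
      have "2 * e - 2 * p \<ge> 2" "2 * e - 2 * p - 2 = 2 * d - 2 * p" using that d by auto
      note rec = ucot_coeff_recurrence[OF assms(1) this(1), unfolded this(2)]
      have *: "real l - real (2 * e - 2 * p) = real (2 * p) - real (s - 1)"
        using e that d assms(2) by (simp add: of_nat_diff)
      have "real l * (b (s - 1) p * ucot_coeff (l + 1) (2 * e - 2 * p)) =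
          b (s - 1) p * (real l * ucot_coeff (l + 1) (2 * e - 2 * p))" by simp
      also have "\<dots> = ((real (2 * p) - real (s - 1)) * b (s - 1) p) * ucot_coeff l (2 * e - 2 * p) -
          real l * (b (s - 1) p * ucot_coeff (l - 1) (2 * d - 2 * p))"
        unfolding rec * by (simp add: algebra_simps)
      finally show ?thesis unfolding b by simp
    qed
    moreover have "real l * b (s - 1) e = real s * b s e"
    proof -
      have "real l = real (2 * e) - real (s - 1)" using e assms(2) by (simp add: of_nat_diff)
      then show ?thesis using b[of e] by simp
    qed
    ultimately show ?thesis
      by (simp add: A_def B_def C_def d sum_distrib_left distrib_left sum_subtractf)
  qed
  then have ABC: "A = real s / real l * C - B" using assms(1) by (simp add: field_simps)
  have "tanh_value (l + 1) s = (-1) ^ \<sigma> * A"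
    using e by (simp add: tanh_value_def A_def b_def \<sigma>_def add.commute)
  \<comment> \<open>The sign exponents of this value and of \<open>tanh_value l (s + 1)\<close>
    differ from \<open>\<sigma>\<close> by one in opposite directions, so both acquire a minus
    sign.\<close>
  moreover have "tanh_value (l - 1) s = - ((-1) ^ \<sigma> * B)"
  proof -
    have "\<sigma> = Suc ((l - 1 + 3 * s) div 2)" "(l - 1 + s) div 2 - 1 = d" "l - 1 + s - 2 = 2 * d"
      using e d assms(1) by (auto simp: \<sigma>_def)
    then show ?thesis by (simp add: tanh_value_def B_def b_def)
  qed
  moreover have "tanh_value l (s + 1) = - ((-1) ^ \<sigma> * C)"
  proof -
    have "(l + 3 * (s + 1)) div 2 = Suc \<sigma>" "(l + (s + 1)) div 2 - 1 = e" "l + (s + 1) - 2 = 2 * e"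
      using e by (auto simp: \<sigma>_def)
    then show ?thesis by (simp add: tanh_value_def C_def b_def)
  qed
  ultimately show ?thesis unfolding ABC by (simp add: algebra_simps)
qed

text \<open>Strong induction on \<open>k\<close> with \<open>s\<close> arbitrary: the step calls (k
  - 2, s) and (k - 1, s + 1), and both keep k + s even and s \<ge> 2. Convergence at 0 may be lost
  on the way, which finite parts tolerate.\<close>

lemma tanh_power_finite_part:
  assumes "s \<ge> 2" "even (k + s)"
  shows "has_finite_part (cut_integral (\<lambda>x. tanh x ^ k / x ^ s)) (tanh_value k s)"
  using assms
proof (induction k arbitrary: s rule: less_induct)
  case (less k)
  consider "k = 0" | "k = 1" | l where "k = l + 1" "l \<ge> 1"
    by (cases k rule: nat.exhaust; cases "k = 1") auto
  then show ?case
  proof cases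
    case 1
    \<comment> \<open>Here 2 p \<le> s - 2 throughout the sum, so every binomial vanishes.\<close>
    then have "tanh_value k s = 0"
      using less.prems unfolding tanh_value_def
      by (auto intro!: sum.neutral simp: binomial_eq_0)
    then show ?thesis using 1 cut_integral_inverse_power[OF less.prems(1)] by simp
  next
    case 2
    then have "odd s" using less.prems by simp
    then obtain q where q: "s = 2 * q + 1" by (elim oddE)
    \<comment> \<open>The binomials vanish for p < q, and the remaining coefficient
      \<open>ucot_coeff 1 0\<close> is 1. The sign exponent has the parity of q.\<close>
    have "tanh_value k s = (-1) ^ q * zeta_term q"
    proof -
      have "(\<Sum>p\<le>q. real ((2 * p) choose (2 * q)) * zeta_term p * ucot_coeff 1 (2 * q - 2 * p)) =
          (\<Sum>p\<in>{q}. real ((2 * p) choose (2 * q)) * zeta_term p * ucot_coeff 1 (2 * q - 2 * p))"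
        by (rule sum.mono_neutral_right) (auto simp: binomial_eq_0)
      moreover have "(k + 3 * s) div 2 = q + 2 * (q + 1)" "(k + s) div 2 - 1 = q" "k + s - 2 = 2 * q"
        using 2 q by auto
      ultimately show ?thesis using 2 q by (simp add: tanh_value_def power_add power_mult)
    qed
    then show ?thesis
      using tanh_finite_part[of q] less.prems(1) 2 q by (simp add: zeta_term_def)
  next
    case 3
    have "has_finite_part (cut_integral (\<lambda>x. tanh x ^ (l + 1) / x ^ s))
        (tanh_value (l - 1) s - real s / real l * tanh_value l (s + 1))"
      using 3 less.prems by (intro tanh_power_finite_part_step less.IH) auto
    then show ?thesis
      using tanh_value_step[of l s] 3 less.prems by simp
  qed
qed

subsection \<open>The convergent integrals\<close>

lemma tanh_le_self:
  assumes "x \<ge> 0" shows "tanh x \<le> (x :: real)"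
proof -
  have "0 - tanh 0 \<le> x - tanh x"
  proof (rule DERIV_nonneg_imp_nondecreasing[OF assms])
    fix y :: real
    show "\<exists>D. ((\<lambda>y. y - tanh y) has_real_derivative D) (at y) \<and> D \<ge> 0"
      by (rule exI[of _ "tanh y ^ 2"]) (auto intro!: derivative_eq_intros simp: cosh_real_nonzero)
  qed
  then show ?thesis by simp
qed

text \<open>A single integrable majorant with an arctan antiderivative: up to 1 it rests on tanh x
  \<le> x and m \<ge> n, beyond 1 on tanh x \<le> 1 and n + 1 \<ge> 2.\<close>

lemma tanh_power_over_power_le:
  assumes "n \<ge> 1" "m \<ge> n" "x > (0::real)"
  shows "tanh x ^ (m + 1) / x ^ (n + 1) \<le> 2 / (1 + x ^ 2)"
proof -
  have t: "0 \<le> tanh x" "tanh x \<le> 1" using assms tanh_real_lt_1[of x] by auto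
  show ?thesis
  proof (cases "x \<le> 1")
    case True
    have "tanh x ^ (m + 1) \<le> tanh x ^ (n + 1)"
      using t assms by (intro power_decreasing) auto
    also have "\<dots> \<le> x ^ (n + 1)"
      using t tanh_le_self assms by (intro power_mono) auto
    finally have "tanh x ^ (m + 1) / x ^ (n + 1) \<le> 1" using assms by simp
    also have "1 \<le> 2 / (1 + x ^ 2)"
      using True assms power_le_one[of x 2] by (simp add: divide_simps add_pos_pos)
    finally show ?thesis .
  next
    case False
    have "tanh x ^ (m + 1) / x ^ (n + 1) \<le> 1 / x ^ 2"
      using False t assms by (intro frac_le power_le_one power_increasing) auto
    also have "\<dots> \<le> 2 / (1 + x ^ 2)"
      using False one_le_power[of x 2] by (simp add: divide_simps add_pos_pos)
    finally show ?thesis .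
  qed
qed

text \<open>Monotone convergence along X = n + 1: the cut intervals increase to the half line, and
  \<open>f\<close> is nonnegative.\<close>

lemma has_integral_of_cut_integral_tendsto:
  fixes f :: "real \<Rightarrow> real"
  assumes cont: "continuous_on {0<..} f" and nonneg: "\<And>x. x > 0 \<Longrightarrow> f x \<ge> 0"
    and lim: "(cut_integral f \<longlongrightarrow> L) at_top"
  shows "(f has_integral L) {0<..}"
proof (rule has_integral_monotone_convergence_increasing)
  define S where "S n = {1 / real (Suc n)..real (Suc n)}" for n
  have S_sub: "S n \<subseteq> {0<..}" for n
    by (auto simp: S_def intro: less_le_trans[of 0 "1 / real (Suc n)"])
  show "((\<lambda>x. if x \<in> S n then f x else 0) has_integral cut_integral f (real (Suc n))) {0<..}" for n
    unfolding has_integral_restrict[OF S_sub] unfolding S_def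
    by (intro integrable_integral integrable_on_cut[OF cont]) auto
  have S_mono: "S n \<subseteq> S (Suc n)" for n
  proof -
    have "1 / real (Suc (Suc n)) \<le> 1 / real (Suc n)" by (intro divide_left_mono) auto
    then show ?thesis by (auto simp: S_def)
  qed
  show "(if x \<in> S n then f x else 0) \<le> (if x \<in> S (Suc n) then f x else 0)" if "x \<in> {0<..}" for n x
    using S_mono[of n] nonneg[of x] that by auto
  show "(\<lambda>n. if x \<in> S n then f x else 0) \<longlonglongrightarrow> f x" if "x \<in> {0<..}" for x
  proof (rule tendsto_eventually)
    have x: "x > 0" using that by simp
    have "eventually (\<lambda>n. real n \<ge> max x (1 / x)) sequentially"
      using filterlim_real_sequentially unfolding filterlim_at_top by blast
    then show "eventually (\<lambda>n. (if x \<in> S n then f x else 0) = f x) sequentially"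
    proof eventually_elim
      case (elim n)
      then have "x \<le> real (Suc n)" "1 / x \<le> real (Suc n)" by auto
      then have "x \<in> S n" using x by (simp add: S_def divide_simps mult.commute)
      then show ?case by simp
    qed
  qed
  show "(\<lambda>n. cut_integral f (real (Suc n))) \<longlonglongrightarrow> L"
    by (rule filterlim_compose[OF lim])
       (rule filterlim_compose[OF filterlim_real_sequentially filterlim_Suc])
qed

lemma has_integral_tanh_power_over_power:
  assumes "n \<ge> 1" "m \<ge> n" "even (m + n)"
  shows "((\<lambda>x::real. tanh x ^ (m + 1) / x ^ (n + 1)) has_integral tanh_value (m + 1) (n + 1)) {0<..}"
proof -
  define f where "f x = tanh x ^ (m + 1) / x ^ (n + 1)" for x :: real
  have cont: "continuous_on {0<..} f"
    unfolding f_def by (auto intro!: continuous_intros simp: cosh_real_nonzero)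
  have nonneg: "f x \<ge> 0" if "x > 0" for x
    using that by (simp add: f_def)
  have "has_finite_part (cut_integral f) (tanh_value (m + 1) (n + 1))"
    unfolding f_def using assms by (intro tanh_power_finite_part) auto
  \<comment> \<open>A uniform bound on the cut integrals identifies the finite part with the
    ordinary limit.\<close>
  moreover have "eventually (\<lambda>X. norm (cut_integral f X) \<le> 2 * pi) at_top"
    using eventually_ge_at_top[of 1]
  proof eventually_elim
    case (elim X)
    have pos: "x > 0" if "x \<in> {1 / X..X}" for x
      using that elim by (auto intro: less_le_trans[of 0 "1 / X"])
    have "1 / X \<le> X" using elim by (simp add: field_simps mult_ge1_I)
    then have int: "((\<lambda>x. 2 / (1 + x ^ 2)) has_integral (2 * arctan X - 2 * arctan (1 / X))) {1 / X..X}"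
      by (intro fundamental_theorem_of_calculus)
         (auto intro!: derivative_eq_intros
           simp: has_real_derivative_iff_has_vector_derivative[symmetric] divide_simps)
    have f_int: "f integrable_on {1 / X..X}" using elim by (intro integrable_on_cut[OF cont]) auto
    have "cut_integral f X \<le> 2 * arctan X - 2 * arctan (1 / X)"
      using has_integral_le[OF integrable_integral[OF f_int] int]
        tanh_power_over_power_le[OF assms(1,2)] pos by (simp add: f_def)
    also have "\<dots> \<le> 2 * pi"
      using arctan_bounded[of X] arctan_bounded[of "1 / X"] by linarith
    finally show ?case using integral_nonneg[OF f_int] nonneg pos by simp
  qed
  ultimately have "(cut_integral f \<longlongrightarrow> tanh_value (m + 1) (n + 1)) at_top"
    by (rule has_finite_part_bounded_imp_tendsto)
  from has_integral_of_cut_integral_tendsto[OF cont nonneg this] show ?thesis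
    by (simp add: f_def[abs_def])
qed

section \<open>The stated form of the sum and the signs of its coefficients\<close>

lemma nat_ceiling_half_le_iff: "nat \<lceil>real n / 2\<rceil> \<le> p \<longleftrightarrow> n \<le> 2 * p"
  by (simp add: nat_le_iff ceiling_le_iff) linarith

lemma tanh_value_eq:
  assumes "m \<ge> n" "even (m + n)"
  shows "tanh_value (m + 1) (n + 1) = (-1) ^ ((m - n) div 2) *
    (\<Sum>p = nat \<lceil>real n / 2\<rceil>..(m + n) div 2. real ((2 * p) choose n) * (2 ^ (2 * p + 1) - 1)
       * (zeta (real (2 * p + 1)) / pi ^ (2 * p)) * ucot_coeff (m + 1) (m + n - 2 * p))"
proof -
  define e where "e = (m + n) div 2"
  obtain d where d: "m = n + 2 * d"
    using assms by (metis dvd_diff_nat even_add evenE le_add_diff_inverse even_diff_nat)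
  \<comment> \<open>The exponent in \<open>tanh_value\<close> exceeds (m - n) / 2 by an even number,
    so the sign is the stated one.\<close>
  have "(m + 1 + 3 * (n + 1)) div 2 = (m - n) div 2 + 2 * (n + 1)"
    "(m + 1 + (n + 1)) div 2 - 1 = e" "m + 1 + (n + 1) - 2 = m + n"
    by (auto simp: d e_def)
  then have "tanh_value (m + 1) (n + 1) = (-1) ^ ((m - n) div 2) *
      (\<Sum>p\<le>e. real ((2 * p) choose n) * zeta_term p * ucot_coeff (m + 1) (m + n - 2 * p))"
    by (simp add: tanh_value_def power_add power_mult)
  also have "(\<Sum>p\<le>e. real ((2 * p) choose n) * zeta_term p * ucot_coeff (m + 1) (m + n - 2 * p)) =
      (\<Sum>p = nat \<lceil>real n / 2\<rceil>..e. real ((2 * p) choose n) * zeta_term p * ucot_coeff (m + 1) (m + n - 2 * p))"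
    by (rule sum.mono_neutral_right)
       (auto simp: nat_ceiling_half_le_iff binomial_eq_0 not_le)
  finally show ?thesis by (simp add: zeta_term_def e_def mult.assoc)
qed

text \<open>Only the u cot u coefficient carries a varying sign. Its index is 2 j with j = (m + n) /
  2 - p, and n \<le> 2 p gives 2 j \<le> m, the range of \<open>sgn_ucot_coeff\<close>. Raising p by
  one lowers j by one, hence the alternation.\<close>

lemma sgn_zeta_coeff:
  assumes "n \<le> 2 * p" "p \<le> (m + n) div 2" "even (m + n)"
  shows "sgn (zeta_coeff m n p) = (-1) ^ ((m - n) div 2) * (-1) ^ ((m + n) div 2 - p)"
proof -
  define j where "j = (m + n) div 2 - p"
  have "2 * ((m + n) div 2) = m + n" using assms(3) by simp
  then have j: "m + n - 2 * p = 2 * j" by (simp add: j_def diff_mult_distrib2)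
  have "2 * j < m + 1" using assms j by linarith
  then have "sgn (ucot_coeff (m + 1) (2 * j)) = (-1) ^ j" by (rule sgn_ucot_coeff)
  moreover have "(2 * p) choose n > 0" using assms by (simp add: zero_less_binomial_iff)
  moreover have "(2::real) ^ (2 * p + 1) - 1 > 0" using one_less_power[of "2::real" "2 * p + 1"] by simp
  moreover have "sgn ((-1 :: real) ^ i) = (-1) ^ i" for i by (cases "even i") auto
  ultimately show ?thesis
    unfolding zeta_coeff_def j j_def[symmetric] by (simp only: sgn_mult) simp
qed

theorem mainTheorem12:
  fixes m n :: nat
  assumes "m \<ge> 1" and "n \<ge> 1" and "m \<ge> n" and "even (m + n)"
  shows "(\<forall>j. 2 * j \<le> m \<longrightarrow> sgn (ucot_coeff (m + 1) (2 * j)) = (-1) ^ j) \<and>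
    ((\<lambda>x::real. tanh x ^ (m + 1) / x ^ (n + 1)) has_integral
       (-1) ^ ((m - n) div 2) *
       (\<Sum>p = nat \<lceil>real n / 2\<rceil>..(m + n) div 2.
          real ((2 * p) choose n) * (2 ^ (2 * p + 1) - 1)
            * (zeta (real (2 * p + 1)) / pi ^ (2 * p))
            * ucot_coeff (m + 1) (m + n - 2 * p))) {0<..} \<and>
    (\<forall>p \<in> {nat \<lceil>real n / 2\<rceil>..(m + n) div 2}. zeta_coeff m n p \<noteq> 0) \<and>
    (\<forall>p. nat \<lceil>real n / 2\<rceil> \<le> p \<and> p + 1 \<le> (m + n) div 2 \<longrightarrow>
       sgn (zeta_coeff m n (p + 1)) = - sgn (zeta_coeff m n p))"
proof (intro conjI allI ballI impI)
  show "sgn (ucot_coeff (m + 1) (2 * j)) = (-1) ^ j" if "2 * j \<le> m" for j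
    using that by (intro sgn_ucot_coeff) simp
  show "((\<lambda>x::real. tanh x ^ (m + 1) / x ^ (n + 1)) has_integral
       (-1) ^ ((m - n) div 2) *
       (\<Sum>p = nat \<lceil>real n / 2\<rceil>..(m + n) div 2.
          real ((2 * p) choose n) * (2 ^ (2 * p + 1) - 1)
            * (zeta (real (2 * p + 1)) / pi ^ (2 * p))
            * ucot_coeff (m + 1) (m + n - 2 * p))) {0<..}"
    using has_integral_tanh_power_over_power[OF assms(2-4)] tanh_value_eq[OF assms(3,4)] by simp
  show "zeta_coeff m n p \<noteq> 0" if "p \<in> {nat \<lceil>real n / 2\<rceil>..(m + n) div 2}" for p
  proof -
    have "sgn (zeta_coeff m n p) \<noteq> 0"
      using that assms(4) by (subst sgn_zeta_coeff) (auto simp: nat_ceiling_half_le_iff)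
    then show ?thesis by auto
  qed
  show "sgn (zeta_coeff m n (p + 1)) = - sgn (zeta_coeff m n p)"
    if "nat \<lceil>real n / 2\<rceil> \<le> p \<and> p + 1 \<le> (m + n) div 2" for p
  proof -
    have "n \<le> 2 * p" "p + 1 \<le> (m + n) div 2" using that by (auto simp: nat_ceiling_half_le_iff)
    moreover from this have "(m + n) div 2 - p = Suc ((m + n) div 2 - (p + 1))" by simp
    ultimately show ?thesis using assms(4) by (simp add: sgn_zeta_coeff)
  qed
qed

end
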